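(* Let $\mathcal R=(G,\Lambda,N)$ be an interval finite, faithful protorootoid, and let $A:=A_{\mathcal R}$ be its set of atomic morphisms, with ${}_aA:=A\cap{}_aG$. Then $\mathcal R$ is a rootoid if and only if it satisfies the following condition: whenever $a\in\mathrm{ob}(G)$, $r,s\in{}_aA$ and $g\in{}_aG$ are such that $N(r)\cap N(g)=N(s)\cap N(g)=\emptyset$ and $N(r),N(s)$ have an upper bound in ${}_a\mathcal L$, then the join $N(r)\vee N(s)$ exists in ${}_a\mathcal L$ and satisfies $(N(r)\vee N(s))\cap N(g)=\emptyset$.
   Context: A groupoid is a small category in which every morphism is invertible; ${}_aG$ is the set of morphisms of $G$ with codomain $a$. A Boolean ring is a (possibly non-unital) ring in which every element is idempotent, partially ordered by $x\subseteq y\iff xy=x$; write $x\cap y=xy$ and $\emptyset=0$. A protorootoid is a triple $\mathcal R=(G,\Lambda,N)$ with $G$ a groupoid, $\Lambda$ a functor from $G$ to the category of Boolean rings and (not necessarily unital) ring homomorphisms, and $N$ a function assigning to each $g\in{}_aG$ an element $N(g)\in\Lambda(a)$ such that $N(gh)=N(g)+\Lambda(g)(N(h))$ whenever $gh$ is defined. The weak order at $a$ is the subposet ${}_a\mathcal L=\{N(g)\mid g\in{}_aG\}$ of $\Lambda(a)$, with minimum $\emptyset$; joins $\vee,\bigvee$ are taken in ${}_a\mathcal L$. $\mathcal R$ is faithful if for $g\in{}_aG$, $N(g)=\emptyset$ implies $g=1_a$. It is interval finite if for all $g\in{}_aG$ the set $\{A\in{}_a\mathcal L\mid A\subseteq N(g)\}$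 is finite. A morphism $s\in{}_aG$ is atomic if $N(s)$ is an atom of the poset ${}_a\mathcal L$. $\mathcal R$ is a rootoid if: (i) for $g,h\in{}_aG$, $N(g)=N(h)$ implies $g=h$; (ii) each ${}_a\mathcal L$ is a complete meet semilattice (every non-empty subset has a meet); (iii) if $A_i$ ($i\in I$) and $B$ in ${}_a\mathcal L$ satisfy $A_i\cap B=\emptyset$ for all $i$ and $A=\bigvee_iA_i$ exists in ${}_a\mathcal L$, then $A\cap B=\emptyset$. *)

theory Defs
  imports "HOL-Algebra.Ring"
begin

section \<open>Groupoids\<close>

text \<open>
  A small category is given by its set of objects and its set of morphisms.  The composite
  \<open>g \<cdot> h\<close> is meaningful when \<open>src g = tgt h\<close>, and then \<open>tgt (g \<cdot> h) = tgt g\<close>.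
\<close>

record ('o, 'm) category_data =
  Ob  :: "'o set"
  Mor :: "'m set"
  src :: "'m \<Rightarrow> 'o"
  tgt :: "'m \<Rightarrow> 'o"
  idn :: "'o \<Rightarrow> 'm"
  cmp :: "'m \<Rightarrow> 'm \<Rightarrow> 'm"  (infixl \<open>\<cdot>\<index>\<close> 70)

locale small_category =
  fixes G :: "('o, 'm, 'z) category_data_scheme" (structure)
  assumes src_closed: "f \<in> Mor G \<Longrightarrow> src G f \<in> Ob G"
    and tgt_closed: "f \<in> Mor G \<Longrightarrow> tgt G f \<in> Ob G"
    and idn_closed: "a \<in> Ob G \<Longrightarrow> idn G a \<in> Mor G"
    and src_idn: "a \<in> Ob G \<Longrightarrow> src G (idn G a) = a"
    and tgt_idn: "a \<in> Ob G \<Longrightarrow> tgt G (idn G a) = a"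
    and cmp_closed: "\<lbrakk>f \<in> Mor G; g \<in> Mor G; src G f = tgt G g\<rbrakk> \<Longrightarrow> f \<cdot> g \<in> Mor G"
    and src_cmp: "\<lbrakk>f \<in> Mor G; g \<in> Mor G; src G f = tgt G g\<rbrakk> \<Longrightarrow> src G (f \<cdot> g) = src G g"
    and tgt_cmp: "\<lbrakk>f \<in> Mor G; g \<in> Mor G; src G f = tgt G g\<rbrakk> \<Longrightarrow> tgt G (f \<cdot> g) = tgt G f"
    and cmp_assoc: "\<lbrakk>f \<in> Mor G; g \<in> Mor G; h \<in> Mor G; src G f = tgt G g; src G g = tgt G h\<rbrakk>
      \<Longrightarrow> (f \<cdot> g) \<cdot> h = f \<cdot> (g \<cdot> h)"
    and idn_cmp: "f \<in> Mor G \<Longrightarrow> idn G (tgt G f) \<cdot> f = f"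
    and cmp_idn: "f \<in> Mor G \<Longrightarrow> f \<cdot> idn G (src G f) = f"

locale groupoid = small_category +
  assumes invertible: "f \<in> Mor G \<Longrightarrow>
    \<exists>g\<in>Mor G. src G g = tgt G f \<and> tgt G g = src G f \<and>
      f \<cdot> g = idn G (tgt G f) \<and> g \<cdot> f = idn G (src G f)"

definition mor_to :: "('o, 'm, 'z) category_data_scheme \<Rightarrow> 'o \<Rightarrow> 'm set"
  where "mor_to G a = {g \<in> Mor G. tgt G g = a}"


section \<open>Boolean rings without unit\<close>

text \<open>
  The record of rings is that of \<^theory>\<open>HOL-Algebra.Ring\<close>, whose locale \<^locale>\<open>ring\<close> and whose
  homomorphisms \<^const>\<open>ring_hom\<close> are unital.  Here the field \<^const>\<open>one\<close> is left unconstrained: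
  Boolean rings need not have a unit, and homomorphisms need not preserve one.
\<close>

locale boolean_rng = abelian_group R for R :: "('b, 'z) ring_scheme" (structure) +
  assumes mult_closed: "\<lbrakk>x \<in> carrier R; y \<in> carrier R\<rbrakk> \<Longrightarrow> x \<otimes> y \<in> carrier R"
    and mult_assoc: "\<lbrakk>x \<in> carrier R; y \<in> carrier R; z \<in> carrier R\<rbrakk>
      \<Longrightarrow> (x \<otimes> y) \<otimes> z = x \<otimes> (y \<otimes> z)"
    and left_distr: "\<lbrakk>x \<in> carrier R; y \<in> carrier R; z \<in> carrier R\<rbrakk>
      \<Longrightarrow> (x \<oplus> y) \<otimes> z = x \<otimes> z \<oplus> y \<otimes> z"
    and right_distr: "\<lbrakk>x \<in> carrier R; y \<in> carrier R; z \<in> carrier R\<rbrakk>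
      \<Longrightarrow> z \<otimes> (x \<oplus> y) = z \<otimes> x \<oplus> z \<otimes> y"
    and mult_idem: "x \<in> carrier R \<Longrightarrow> x \<otimes> x = x"

definition rng_hom :: "('b, 'y) ring_scheme \<Rightarrow> ('c, 'z) ring_scheme \<Rightarrow> ('b \<Rightarrow> 'c) set"
  where "rng_hom R S = {f. f \<in> carrier R \<rightarrow> carrier S \<and>
    (\<forall>x\<in>carrier R. \<forall>y\<in>carrier R.
      f (x \<oplus>\<^bsub>R\<^esub> y) = f x \<oplus>\<^bsub>S\<^esub> f y \<and> f (x \<otimes>\<^bsub>R\<^esub> y) = f x \<otimes>\<^bsub>S\<^esub> f y)}"


section \<open>Protorootoids\<close>

text \<open>
  A triple \<open>(G, \<Lambda>, N)\<close>: the inherited fields are \<open>G\<close>, the fields \<open>Lam\<close> and \<open>Lam_map\<close> are the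
  functor \<open>\<Lambda>\<close> on objects and on morphisms, and \<open>cocycle\<close> is \<open>N\<close>.  The Boolean rings at the
  various objects may have different carriers and operations, within one type \<open>'b\<close>.
\<close>

record ('o, 'm, 'b) protorootoid_data = "('o, 'm) category_data" +
  Lam     :: "'o \<Rightarrow> 'b ring"
  Lam_map :: "'m \<Rightarrow> 'b \<Rightarrow> 'b"
  cocycle :: "'m \<Rightarrow> 'b"

locale protorootoid = groupoid R
  for R :: "('o, 'm, 'b, 'z) protorootoid_data_scheme" (structure) +
  assumes Lam_boolean: "a \<in> Ob R \<Longrightarrow> boolean_rng (Lam R a)"
    and Lam_map_hom: "g \<in> Mor R \<Longrightarrow> Lam_map R g \<in> rng_hom (Lam R (src R g)) (Lam R (tgt R g))"
    and Lam_map_idn: "\<lbrakk>a \<in> Ob R; x \<in> carrier (Lam R a)\<rbrakk> \<Longrightarrow> Lam_map R (idn R a) x = x"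
    and Lam_map_cmp: "\<lbrakk>g \<in> Mor R; h \<in> Mor R; src R g = tgt R h; x \<in> carrier (Lam R (src R h))\<rbrakk>
      \<Longrightarrow> Lam_map R (g \<cdot> h) x = Lam_map R g (Lam_map R h x)"
    and cocycle_closed: "g \<in> Mor R \<Longrightarrow> cocycle R g \<in> carrier (Lam R (tgt R g))"
    and cocycle_cmp: "\<lbrakk>g \<in> Mor R; h \<in> Mor R; src R g = tgt R h\<rbrakk>
      \<Longrightarrow> cocycle R (g \<cdot> h) = cocycle R g \<oplus>\<^bsub>Lam R (tgt R g)\<^esub> Lam_map R g (cocycle R h)"

definition weak_order :: "('o, 'm, 'b, 'z) protorootoid_data_scheme \<Rightarrow> 'o \<Rightarrow> 'b gorder"
  where "weak_order R a =
    \<lparr>carrier = cocycle R ` mor_to R a, eq = (=), le = (\<lambda>x y. x \<otimes>\<^bsub>Lam R a\<^esub> y = x)\<rparr>"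

definition faithful :: "('o, 'm, 'b, 'z) protorootoid_data_scheme \<Rightarrow> bool"
  where "faithful R \<longleftrightarrow>
    (\<forall>a\<in>Ob R. \<forall>g\<in>mor_to R a. cocycle R g = \<zero>\<^bsub>Lam R a\<^esub> \<longrightarrow> g = idn R a)"

definition interval_finite :: "('o, 'm, 'b, 'z) protorootoid_data_scheme \<Rightarrow> bool"
  where "interval_finite R \<longleftrightarrow>
    (\<forall>a\<in>Ob R. \<forall>g\<in>mor_to R a.
      finite {x \<in> carrier (weak_order R a). x \<sqsubseteq>\<^bsub>weak_order R a\<^esub> cocycle R g})"

text \<open>An atom of a poset with minimum is a minimal element among those other than the minimum.\<close>

definition is_atom :: "('b, 'z) gorder_scheme \<Rightarrow> 'b \<Rightarrow> bool"
  where "is_atom L x \<longleftrightarrow> x \<in> carrier L \<and> \<not> least L x (carrier L) \<and>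
    (\<forall>y\<in>carrier L. y \<sqsubseteq>\<^bsub>L\<^esub> x \<longrightarrow> least L y (carrier L) \<or> y .=\<^bsub>L\<^esub> x)"

definition atomic_morphisms :: "('o, 'm, 'b, 'z) protorootoid_data_scheme \<Rightarrow> 'm set"
  where "atomic_morphisms R =
    {s \<in> Mor R. is_atom (weak_order R (tgt R s)) (cocycle R s)}"


section \<open>Rootoids\<close>

definition complete_meet_semilattice :: "('b, 'z) gorder_scheme \<Rightarrow> bool"
  where "complete_meet_semilattice L \<longleftrightarrow>
    partial_order L \<and> (\<forall>X. X \<subseteq> carrier L \<and> X \<noteq> {} \<longrightarrow> (\<exists>m. is_glb L m X))"

text \<open>In \<open>join_orthogonal\<close>, the family \<open>(A\<^sub>i)\<close> is given by its set \<open>X\<close> of values.\<close>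

locale rootoid = protorootoid R
  for R :: "('o, 'm, 'b, 'z) protorootoid_data_scheme" (structure) +
  assumes cocycle_inj: "a \<in> Ob R \<Longrightarrow> inj_on (cocycle R) (mor_to R a)"
    and weak_order_meets: "a \<in> Ob R \<Longrightarrow> complete_meet_semilattice (weak_order R a)"
    and join_orthogonal: "\<lbrakk>a \<in> Ob R; X \<subseteq> carrier (weak_order R a); B \<in> carrier (weak_order R a);
        \<And>A. A \<in> X \<Longrightarrow> A \<otimes>\<^bsub>Lam R a\<^esub> B = \<zero>\<^bsub>Lam R a\<^esub>; is_lub (weak_order R a) J X\<rbrakk>
      \<Longrightarrow> J \<otimes>\<^bsub>Lam R a\<^esub> B = \<zero>\<^bsub>Lam R a\<^esub>"

end

theory Submission
  imports Defs
begin

text \<open>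
  For \<open>r\<close> below \<open>u\<close> in the weak order at \<open>a\<close>, left multiplication by the inverse of \<open>r\<close> identifies
  the interval from \<open>r\<close> to \<open>u\<close> with an initial interval of the weak order at the source of \<open>r\<close>;
  on values of the cocycle it is \<open>x \<mapsto> \<Lambda>(r\<^sup>-\<^sup>1)(N(r) + x)\<close>, and it preserves orthogonality to
  elements orthogonal to \<open>r\<close>.  If \<open>r \<noteq> 1\<close>, the interval has shrunk.  So one shows by induction on
  the size of the interval below \<open>u\<close> that any \<open>x, y \<le> u\<close> have a join, orthogonal to everything
  orthogonal to both: choose atoms \<open>r \<le> x\<close> and \<open>s \<le> y\<close>, let \<open>m = r \<or> s\<close>, and form \<open>p = x \<or> m\<close>
  above \<open>r\<close> and then \<open>p \<or> y = x \<or> y\<close> above \<open>s\<close>.  Meets of arbitrary families, and orthogonality of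
  arbitrary joins, follow because a non-empty finite family closed under joins has a greatest
  element.
\<close>

section \<open>Boolean rings\<close>

context boolean_rng
begin

lemma add_left_cancel:
  assumes "x \<in> carrier R" "y \<in> carrier R" "z \<in> carrier R"
  shows "x \<oplus> y = x \<oplus> z \<longleftrightarrow> y = z"
  using assms by (metis a_assoc a_inv_closed l_neg l_zero)

text \<open>Expanding the square of the idempotent \<open>x \<oplus> x\<close> yields two copies of
  it, and one copy cancels.\<close>

lemma add_self:
  assumes x: "x \<in> carrier R"
  shows "x \<oplus> x = \<zero>"
proof -
  have "x \<oplus> x = (x \<oplus> x) \<otimes> (x \<oplus> x)" using x by (simp add: mult_idem)
  also have "\<dots> = (x \<otimes> x \<oplus> x \<otimes> x) \<oplus> (x \<otimes> x \<oplus> x \<otimes> x)"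
    using x by (simp add: left_distr right_distr mult_closed)
  also have "\<dots> = (x \<oplus> x) \<oplus> (x \<oplus> x)" using x by (simp add: mult_idem)
  finally show ?thesis using x by simp
qed

lemma add_eq_zero_iff:
  assumes "x \<in> carrier R" "y \<in> carrier R"
  shows "x \<oplus> y = \<zero> \<longleftrightarrow> x = y"
  using assms add_self by (metis add_left_cancel)

text \<open>Expanding the square of \<open>x \<oplus> y\<close> leaves
  \<open>x \<otimes> y \<oplus> y \<otimes> x = \<zero>\<close>; characteristic 2 turns this into an
  equality.\<close>

lemma mult_commute:
  assumes x: "x \<in> carrier R" and y: "y \<in> carrier R"
  shows "x \<otimes> y = y \<otimes> x"
proof -
  have "x \<oplus> y = (x \<oplus> y) \<otimes> (x \<oplus> y)" using x y by (simp add: mult_idem)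
  also have "\<dots> = (x \<otimes> x \<oplus> y \<otimes> y) \<oplus> (x \<otimes> y \<oplus> y \<otimes> x)"
    using x y by (simp add: left_distr right_distr mult_closed a_ac)
  also have "\<dots> = (x \<oplus> y) \<oplus> (x \<otimes> y \<oplus> y \<otimes> x)" using x y by (simp add: mult_idem)
  finally have "x \<otimes> y \<oplus> y \<otimes> x = \<zero>"
    using x y by (simp add: mult_closed)
  then show ?thesis using x y by (simp add: add_eq_zero_iff mult_closed)
qed

lemma mult_zero:
  assumes x: "x \<in> carrier R"
  shows "x \<otimes> \<zero> = \<zero>" and "\<zero> \<otimes> x = \<zero>"
proof -
  have "x \<otimes> \<zero> \<oplus> x \<otimes> \<zero> = x \<otimes> \<zero>" using x by (metis right_distr r_zero zero_closed)
  then show *: "x \<otimes> \<zero> = \<zero>" using x by (simp add: add_self mult_closed)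
  show "\<zero> \<otimes> x = \<zero>" using * mult_commute x by simp
qed

lemma below_orthogonal:
  assumes "x \<in> carrier R" "y \<in> carrier R" "g \<in> carrier R" "x \<otimes> y = x" "y \<otimes> g = \<zero>"
  shows "x \<otimes> g = \<zero>"
  using assms by (metis mult_assoc mult_zero(1))

text \<open>For \<open>r\<close> below \<open>x\<close>, the sum \<open>r \<oplus> x\<close> is the relative complement of \<open>r\<close> in \<open>x\<close>.\<close>

lemma complement_mult:
  assumes "r \<in> carrier R" "x \<in> carrier R" "y \<in> carrier R" "r \<otimes> x = r" "r \<otimes> y = r"
  shows "(r \<oplus> x) \<otimes> (r \<oplus> y) = r \<oplus> x \<otimes> y"
proof -
  have "(r \<oplus> x) \<otimes> (r \<oplus> y) = (r \<oplus> r) \<oplus> (r \<oplus> x \<otimes> y)"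
    using assms by (simp add: left_distr right_distr mult_closed mult_idem mult_commute[of x r] a_ac)
  then show ?thesis using assms by (simp add: add_self mult_closed)
qed

lemma complement_below_iff:
  assumes "r \<in> carrier R" "x \<in> carrier R" "y \<in> carrier R" "r \<otimes> x = r" "r \<otimes> y = r"
  shows "(r \<oplus> x) \<otimes> (r \<oplus> y) = r \<oplus> x \<longleftrightarrow> x \<otimes> y = x"
  using assms by (simp add: complement_mult mult_closed)

text \<open>Since \<open>g\<close> is disjoint from \<open>r\<close>, the sum
  \<open>r \<oplus> g\<close> is their union, while \<open>r \<oplus> x\<close> is \<open>x\<close>
  with \<open>r\<close> removed; what they share is \<open>x \<otimes> g\<close>. This is why
  translation respects orthogonality to such \<open>g\<close>.\<close>

lemma complement_orthogonal_iff:
  assumes "r \<in> carrier R" "x \<in> carrier R" "g \<in> carrier R" "r \<otimes> x = r" "r \<otimes> g = \<zero>"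
  shows "(r \<oplus> x) \<otimes> (r \<oplus> g) = \<zero> \<longleftrightarrow> x \<otimes> g = \<zero>"
proof -
  have "(r \<oplus> x) \<otimes> (r \<oplus> g) = (r \<oplus> r) \<oplus> x \<otimes> g"
    using assms
    by (simp add: left_distr right_distr mult_closed mult_idem mult_commute[of x r] mult_zero a_ac)
  then show ?thesis using assms by (simp add: add_self mult_closed)
qed

text \<open>The complement \<open>r \<oplus> u\<close> is disjoint from \<open>r\<close>, hence so
  is \<open>r \<oplus> z\<close>, and \<open>r \<otimes> (r \<oplus> z) = \<zero>\<close> says that
  \<open>r\<close> is below \<open>z\<close>. It shows that nothing from outside the interval
  between \<open>r\<close> and \<open>u\<close> is translated below the image of
  \<open>u\<close>.\<close>

lemma below_of_complement_below:
  assumes "r \<in> carrier R" "z \<in> carrier R" "u \<in> carrier R" "r \<otimes> u = r"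
    and "(r \<oplus> z) \<otimes> (r \<oplus> u) = r \<oplus> z"
  shows "r \<otimes> z = r"
proof -
  have "r \<otimes> (r \<oplus> u) = \<zero>" using assms by (simp add: right_distr mult_idem add_self)
  then have "(r \<oplus> z) \<otimes> r = \<zero>"
    using assms by (metis a_closed mult_assoc mult_commute mult_zero(2))
  then have "r \<oplus> r \<otimes> z = \<zero>"
    using assms by (simp add: left_distr mult_idem mult_commute[of z r])
  then show ?thesis using assms by (simp add: add_eq_zero_iff mult_closed)
qed

end

lemma rng_hom_zero:
  assumes "boolean_rng A" "boolean_rng B" "f \<in> rng_hom A B"
  shows "f \<zero>\<^bsub>A\<^esub> = \<zero>\<^bsub>B\<^esub>"
proof -
  interpret A: boolean_rng A by fact
  interpret B: boolean_rng B by fact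
  have f0: "f \<zero>\<^bsub>A\<^esub> \<in> carrier B" using assms(3) by (auto simp: rng_hom_def)
  have "f (\<zero>\<^bsub>A\<^esub> \<oplus>\<^bsub>A\<^esub> \<zero>\<^bsub>A\<^esub>) = f \<zero>\<^bsub>A\<^esub> \<oplus>\<^bsub>B\<^esub> f \<zero>\<^bsub>A\<^esub>"
    using assms(3) A.zero_closed unfolding rng_hom_def by blast
  then show ?thesis using f0 by simp
qed

section \<open>The weak order\<close>

lemma weak_order_simps [simp]:
  "carrier (weak_order R a) = cocycle R ` mor_to R a"
  "x \<sqsubseteq>\<^bsub>weak_order R a\<^esub> y \<longleftrightarrow> x \<otimes>\<^bsub>Lam R a\<^esub> y = x"
  "x .=\<^bsub>weak_order R a\<^esub> y \<longleftrightarrow> x = y"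
  by (simp_all add: weak_order_def)

lemma is_lub_pair_iff:
  assumes "x \<in> carrier L" "y \<in> carrier L"
  shows "is_lub L j {x, y} \<longleftrightarrow> j \<in> carrier L \<and> x \<sqsubseteq>\<^bsub>L\<^esub> j \<and> y \<sqsubseteq>\<^bsub>L\<^esub> j \<and>
    (\<forall>w\<in>carrier L. x \<sqsubseteq>\<^bsub>L\<^esub> w \<longrightarrow> y \<sqsubseteq>\<^bsub>L\<^esub> w \<longrightarrow> j \<sqsubseteq>\<^bsub>L\<^esub> w)"
  using assms unfolding least_def Upper_def by auto

text \<open>Every finite subset \<open>F\<close> of \<open>D\<close> gets an upper bound inside
  \<open>D\<close>, one element at a time; \<open>F = D\<close> gives the greatest element.\<close>

lemma (in partial_order) finite_directed_greatest:
  assumes "finite D" "D \<noteq> {}" "D \<subseteq> carrier L"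
    and dir: "\<And>x y. x \<in> D \<Longrightarrow> y \<in> D \<Longrightarrow> \<exists>z\<in>D. x \<sqsubseteq> z \<and> y \<sqsubseteq> z"
  shows "\<exists>m. greatest L m D"
proof -
  have "\<exists>m\<in>D. \<forall>x\<in>F. x \<sqsubseteq> m" if "finite F" "F \<subseteq> D" for F
    using that
  proof (induction F rule: finite_induct)
    case empty
    then show ?case using assms(2) by auto
  next
    case (insert x F)
    then obtain m where m: "m \<in> D" "\<forall>y\<in>F. y \<sqsubseteq> m" by auto
    obtain z where z: "z \<in> D" "x \<sqsubseteq> z" "m \<sqsubseteq> z" using dir insert.prems m(1) by blast
    have "y \<sqsubseteq> z" if "y \<in> F" for y
      using that m z insert.prems assms(3) by (meson insert_subset le_trans subset_iff)
    then show ?case using z by blast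
  qed
  then show ?thesis using assms(1,3) by (meson greatest_def subset_refl)
qed

context protorootoid
begin

text \<open>The cocycle identity for the idempotent \<open>idn R a\<close> gives
  \<open>c = c \<oplus> c\<close> for its value \<open>c\<close>, and \<open>c \<oplus> c\<close>
  vanishes.\<close>

lemma cocycle_idn:
  assumes a: "a \<in> Ob R"
  shows "cocycle R (idn R a) = \<zero>\<^bsub>Lam R a\<^esub>"
proof -
  interpret L: boolean_rng "Lam R a" using Lam_boolean a by simp
  let ?e = "idn R a"
  have e: "?e \<in> Mor R" "src R ?e = a" "tgt R ?e = a" using a idn_closed src_idn tgt_idn by auto
  have c: "cocycle R ?e \<in> carrier (Lam R a)" using cocycle_closed[OF e(1)] e by simp
  have "?e \<cdot> ?e = ?e" using idn_cmp[OF e(1)] e by simp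
  then have "cocycle R ?e = cocycle R ?e \<oplus>\<^bsub>Lam R a\<^esub> cocycle R ?e"
    using cocycle_cmp[OF e(1) e(1)] e a c Lam_map_idn by simp
  then show ?thesis using c by (simp add: L.add_self)
qed

lemma cocycle_in_Lam: "g \<in> mor_to R a \<Longrightarrow> cocycle R g \<in> carrier (Lam R a)"
  using cocycle_closed by (auto simp: mor_to_def)

lemma weak_order_zero: "a \<in> Ob R \<Longrightarrow> \<zero>\<^bsub>Lam R a\<^esub> \<in> carrier (weak_order R a)"
  using cocycle_idn idn_closed tgt_idn by (force simp: mor_to_def)

lemma weak_order_subset: "x \<in> carrier (weak_order R a) \<Longrightarrow> x \<in> carrier (Lam R a)"
  using cocycle_in_Lam by auto

lemma partial_order_weak_order:
  assumes a: "a \<in> Ob R"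
  shows "partial_order (weak_order R a)"
proof -
  interpret L: boolean_rng "Lam R a" using Lam_boolean a by simp
  show ?thesis
  proof unfold_locales
    fix x y z
    assume "x \<in> carrier (weak_order R a)" "y \<in> carrier (weak_order R a)"
      "z \<in> carrier (weak_order R a)"
    note c = this[THEN weak_order_subset]
    assume "x \<sqsubseteq>\<^bsub>weak_order R a\<^esub> y" "y \<sqsubseteq>\<^bsub>weak_order R a\<^esub> z"
    then show "x \<sqsubseteq>\<^bsub>weak_order R a\<^esub> z" using c L.mult_assoc[of x y z] by simp
  next
    fix x y
    assume "x \<in> carrier (weak_order R a)" "y \<in> carrier (weak_order R a)"
    note c = this[THEN weak_order_subset]
    assume "x \<sqsubseteq>\<^bsub>weak_order R a\<^esub> y" "y \<sqsubseteq>\<^bsub>weak_order R a\<^esub> x"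
    then show "x .=\<^bsub>weak_order R a\<^esub> y" using c L.mult_commute[of x y] by simp
  next
    fix x
    assume "x \<in> carrier (weak_order R a)"
    note c = this[THEN weak_order_subset]
    then show "x \<sqsubseteq>\<^bsub>weak_order R a\<^esub> x" using L.mult_idem by simp
  qed (auto simp: weak_order_def)
qed

text \<open>Atoms are defined through least elements; this lets them be tested against zero.\<close>

lemma weak_order_least_iff:
  assumes a: "a \<in> Ob R"
  shows "least (weak_order R a) x (carrier (weak_order R a)) \<longleftrightarrow> x = \<zero>\<^bsub>Lam R a\<^esub>"
proof -
  interpret L: boolean_rng "Lam R a" using Lam_boolean a by simp
  show ?thesis
    using weak_order_zero[OF a] L.mult_zero weak_order_subset[of _ a]
    unfolding least_def by (auto; metis imageI)
qed

text \<open>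
  The map is \<open>N(h) \<mapsto> N(r\<^sup>-\<^sup>1 h)\<close>, rewritten using \<open>N(r\<^sup>-\<^sup>1) = \<Lambda>(r\<^sup>-\<^sup>1)(N(r))\<close>, which holds because
  Boolean rings have characteristic 2.
\<close>

lemma weak_order_translate:
  assumes r: "r \<in> mor_to R a"
  shows "\<exists>b \<phi>. b \<in> Ob R \<and> \<phi> \<in> rng_hom (Lam R a) (Lam R b) \<and> inj_on \<phi> (carrier (Lam R a)) \<and>
    (\<lambda>x. \<phi> (cocycle R r \<oplus>\<^bsub>Lam R a\<^esub> x)) ` carrier (weak_order R a) = carrier (weak_order R b)"
proof -
  have rM: "r \<in> Mor R" "tgt R r = a" using r by (auto simp: mor_to_def)
  then have a: "a \<in> Ob R" using tgt_closed by blast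
  obtain r' where r': "r' \<in> Mor R" "src R r' = a" "tgt R r' = src R r"
    "r \<cdot> r' = idn R a" "r' \<cdot> r = idn R (src R r)"
    using invertible[OF rM(1)] rM by auto
  define b where "b = src R r"
  define \<phi> where "\<phi> = Lam_map R r'"
  have b: "b \<in> Ob R" using src_closed rM b_def by simp
  interpret A: boolean_rng "Lam R a" using Lam_boolean a by simp
  interpret B: boolean_rng "Lam R b" using Lam_boolean b by simp
  have \<phi>: "\<phi> \<in> rng_hom (Lam R a) (Lam R b)" using Lam_map_hom[OF r'(1)] r' by (simp add: b_def \<phi>_def)
  have Nr: "cocycle R r \<in> carrier (Lam R a)" using r cocycle_in_Lam by simp
  \<comment> \<open>Functoriality applied to \<open>r \<cdot> r' = idn R a\<close>: the map of
    \<open>r\<close> is a left inverse of \<open>\<phi>\<close>.\<close>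
  have "Lam_map R r (\<phi> x) = x" if "x \<in> carrier (Lam R a)" for x
    using Lam_map_cmp[OF rM(1) r'(1)] r' that Lam_map_idn[OF a] by (simp add: \<phi>_def)
  then have inj: "inj_on \<phi> (carrier (Lam R a))" by (rule inj_on_inverseI)
  \<comment> \<open>The cocycle identity for \<open>r' \<cdot> r\<close>, which is the identity at
    \<open>b\<close>.\<close>
  have "\<zero>\<^bsub>Lam R b\<^esub> = cocycle R r' \<oplus>\<^bsub>Lam R b\<^esub> \<phi> (cocycle R r)"
    using cocycle_cmp[OF r'(1) rM(1)] r' rM cocycle_idn[OF b] by (simp add: b_def \<phi>_def)
  moreover have "cocycle R r' \<in> carrier (Lam R b)"
    using cocycle_closed[OF r'(1)] r' by (simp add: b_def)
  moreover have "\<phi> (cocycle R r) \<in> carrier (Lam R b)"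
    using \<phi> Nr by (auto simp: rng_hom_def)
  ultimately have Nr': "cocycle R r' = \<phi> (cocycle R r)"
    using B.add_eq_zero_iff[of "cocycle R r'" "\<phi> (cocycle R r)"] by simp
  have tr: "\<phi> (cocycle R r \<oplus>\<^bsub>Lam R a\<^esub> cocycle R h) = cocycle R (r' \<cdot> h)" "r' \<cdot> h \<in> mor_to R b"
    if h: "h \<in> mor_to R a" for h
  proof -
    have hM: "h \<in> Mor R" "tgt R h = a" using h by (auto simp: mor_to_def)
    have "\<phi> (cocycle R r \<oplus>\<^bsub>Lam R a\<^esub> cocycle R h) = cocycle R r' \<oplus>\<^bsub>Lam R b\<^esub> \<phi> (cocycle R h)"
      using \<phi> Nr cocycle_in_Lam[OF h] Nr' by (auto simp: rng_hom_def)
    then show "\<phi> (cocycle R r \<oplus>\<^bsub>Lam R a\<^esub> cocycle R h) = cocycle R (r' \<cdot> h)"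
      using cocycle_cmp[OF r'(1) hM(1)] hM r' by (simp add: b_def \<phi>_def)
    show "r' \<cdot> h \<in> mor_to R b"
      using cmp_closed tgt_cmp r' hM by (simp add: mor_to_def b_def)
  qed
  have img: "(\<lambda>x. \<phi> (cocycle R r \<oplus>\<^bsub>Lam R a\<^esub> x)) ` carrier (weak_order R a) = carrier (weak_order R b)"
  proof
    show "(\<lambda>x. \<phi> (cocycle R r \<oplus>\<^bsub>Lam R a\<^esub> x)) ` carrier (weak_order R a) \<subseteq> carrier (weak_order R b)"
      using tr by auto
    show "carrier (weak_order R b) \<subseteq> (\<lambda>x. \<phi> (cocycle R r \<oplus>\<^bsub>Lam R a\<^esub> x)) ` carrier (weak_order R a)"
    proof
      fix y assume "y \<in> carrier (weak_order R b)"
      then obtain z where z: "z \<in> Mor R" "tgt R z = b" "y = cocycle R z"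
        by (auto simp: mor_to_def)
      \<comment> \<open>The preimage of \<open>cocycle R z\<close> is the value at
        \<open>r \<cdot> z\<close>, because left multiplication by \<open>r'\<close> undoes that by
        \<open>r\<close>.\<close>
      have rz: "r \<cdot> z \<in> mor_to R a" using z rM cmp_closed tgt_cmp by (simp add: mor_to_def b_def)
      have "r' \<cdot> (r \<cdot> z) = z"
        using cmp_assoc[OF r'(1) rM(1) z(1)] z rM r' idn_cmp[OF z(1)] by (simp add: b_def)
      then have "y = \<phi> (cocycle R r \<oplus>\<^bsub>Lam R a\<^esub> cocycle R (r \<cdot> z))" using tr(1)[OF rz] z by simp
      then show "y \<in> (\<lambda>x. \<phi> (cocycle R r \<oplus>\<^bsub>Lam R a\<^esub> x)) ` carrier (weak_order R a)"
        using rz by auto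
    qed
  qed
  show ?thesis using b \<phi> inj img by blast
qed

text \<open>Equal values at \<open>r\<close> and \<open>h\<close> stay equal after composing with
  the inverse \<open>r'\<close>, so \<open>r' \<cdot> h\<close> has the value of an identity, and
  faithfulness makes it one.\<close>

lemma faithful_cocycle_inj:
  assumes "faithful R"
  shows "inj_on (cocycle R) (mor_to R a)"
proof (rule inj_onI)
  fix r h assume "r \<in> mor_to R a" and "h \<in> mor_to R a" and eq: "cocycle R r = cocycle R h"
  then have r: "r \<in> Mor R" "tgt R r = a" and h: "h \<in> Mor R" "tgt R h = a"
    by (auto simp: mor_to_def)
  obtain r' where r': "r' \<in> Mor R" "src R r' = a" "tgt R r' = src R r"
    "r \<cdot> r' = idn R a" "r' \<cdot> r = idn R (src R r)"
    using invertible[OF r(1)] r by auto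
  have "cocycle R (r' \<cdot> h) = cocycle R (r' \<cdot> r)"
    using cocycle_cmp[OF r'(1) r(1)] cocycle_cmp[OF r'(1) h(1)] r h r'(2,3) eq by simp
  also have "\<dots> = \<zero>\<^bsub>Lam R (src R r)\<^esub>" using r' cocycle_idn src_closed r(1) by simp
  moreover have "r' \<cdot> h \<in> mor_to R (src R r)"
    using cmp_closed tgt_cmp r' h by (simp add: mor_to_def)
  ultimately have "r' \<cdot> h = idn R (src R r)"
    using assms src_closed[OF r(1)] unfolding faithful_def by simp
  moreover have "r \<cdot> (r' \<cdot> h) = h"
    using cmp_assoc[OF r(1) r'(1) h(1)] h r r' idn_cmp[OF h(1)] by simp
  ultimately show "r = h" using cmp_idn[OF r(1)] by simp
qed

section \<open>Orthogonal joins\<close>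

abbreviation lower_set
  where "lower_set a u \<equiv> {x \<in> carrier (weak_order R a). x \<sqsubseteq>\<^bsub>weak_order R a\<^esub> u}"

text \<open>One join serves all \<open>g\<close> at once, whereas the condition on atoms asks for a
  join separately for each \<open>g\<close>. Uniqueness of joins reconciles the two, and this form
  can be carried through the induction.\<close>

definition orthogonal_join
  where "orthogonal_join a x y j \<longleftrightarrow> is_lub (weak_order R a) j {x, y} \<and>
    (\<forall>g\<in>carrier (weak_order R a).
      x \<otimes>\<^bsub>Lam R a\<^esub> g = \<zero>\<^bsub>Lam R a\<^esub> \<longrightarrow> y \<otimes>\<^bsub>Lam R a\<^esub> g = \<zero>\<^bsub>Lam R a\<^esub> \<longrightarrow> j \<otimes>\<^bsub>Lam R a\<^esub> g = \<zero>\<^bsub>Lam R a\<^esub>)"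

text \<open>Among the nonzero elements below \<open>x\<close>, one with the fewest elements below it
  is an atom: a smaller nonzero element would have a strictly smaller finite lower set.\<close>

lemma exists_atom_below:
  assumes a: "a \<in> Ob R" and x: "x \<in> carrier (weak_order R a)" "x \<noteq> \<zero>\<^bsub>Lam R a\<^esub>"
    and fin: "finite (lower_set a x)"
  shows "\<exists>r \<in> atomic_morphisms R \<inter> mor_to R a. cocycle R r \<sqsubseteq>\<^bsub>weak_order R a\<^esub> x"
proof -
  interpret P: partial_order "weak_order R a" using partial_order_weak_order a .
  let ?S = "lower_set a x - {\<zero>\<^bsub>Lam R a\<^esub>}"
  have "x \<in> ?S" using x P.le_refl by blast
  then obtain y where y: "y \<in> ?S"
    and min: "\<forall>z\<in>?S. card (lower_set a y) \<le> card (lower_set a z)"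
    using ex_has_least_nat[of "\<lambda>z. z \<in> ?S" x "\<lambda>z. card (lower_set a z)"] by blast
  have y': "y \<in> carrier (weak_order R a)" "y \<sqsubseteq>\<^bsub>weak_order R a\<^esub> x" "y \<noteq> \<zero>\<^bsub>Lam R a\<^esub>"
    using y by auto
  have "z = y" if z: "z \<in> carrier (weak_order R a)" "z \<sqsubseteq>\<^bsub>weak_order R a\<^esub> y" "z \<noteq> \<zero>\<^bsub>Lam R a\<^esub>" for z
  proof (rule ccontr)
    assume "z \<noteq> y"
    have "z \<in> ?S" using z y' x P.le_trans[of z y x] by blast
    have sub: "lower_set a z \<subseteq> lower_set a y" using P.le_trans[OF _ z(2) _ z(1) y'(1)] by blast
    have "y \<notin> lower_set a z" using P.le_antisym[of z y] z y' \<open>z \<noteq> y\<close> by auto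
    moreover have "y \<in> lower_set a y" using y' P.le_refl by blast
    ultimately have "lower_set a z \<subset> lower_set a y" using sub by blast
    moreover have "lower_set a y \<subseteq> lower_set a x" using P.le_trans[OF _ y'(2) _ y'(1) x(1)] by blast
    then have "finite (lower_set a y)" using fin finite_subset by blast
    ultimately have "card (lower_set a z) < card (lower_set a y)" by (intro psubset_card_mono)
    then show False using bspec[OF min \<open>z \<in> ?S\<close>] by linarith
  qed
  then have "is_atom (weak_order R a) y"
    using y' unfolding is_atom_def weak_order_least_iff[OF a] by auto
  moreover obtain r where "r \<in> mor_to R a" "y = cocycle R r" using y' by auto
  ultimately show ?thesis using y' by (auto simp: atomic_morphisms_def mor_to_def)
qed

text \<open>This is the inductive step for two elements above a common nonzero value: translate by
  the inverse of \<open>r\<close>, take the join over the smaller lower set, and pull it back.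
  \<open>IH\<close> ranges over all objects because translation moves \<open>a\<close> to the source
  of \<open>r\<close>.\<close>

lemma orthogonal_join_translate:
  assumes r: "r \<in> mor_to R a" "cocycle R r \<noteq> \<zero>\<^bsub>Lam R a\<^esub>"
    and u: "u \<in> carrier (weak_order R a)" "finite (lower_set a u)"
    and x: "x \<in> lower_set a u" "cocycle R r \<sqsubseteq>\<^bsub>weak_order R a\<^esub> x"
    and y: "y \<in> lower_set a u" "cocycle R r \<sqsubseteq>\<^bsub>weak_order R a\<^esub> y"
    and IH: "\<And>b v x y. \<lbrakk>b \<in> Ob R; v \<in> carrier (weak_order R b);
        card (lower_set b v) < card (lower_set a u);
        x \<in> lower_set b v; y \<in> lower_set b v\<rbrakk> \<Longrightarrow> \<exists>j. orthogonal_join b x y j"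
  shows "\<exists>j. orthogonal_join a x y j"
proof -
  have a: "a \<in> Ob R" using r tgt_closed by (auto simp: mor_to_def)
  define L where "L = carrier (weak_order R a)"
  define n where "n = cocycle R r"
  define A where "A = Lam R a"
  obtain b \<phi> where b: "b \<in> Ob R" and \<phi>: "\<phi> \<in> rng_hom A (Lam R b)" and inj: "inj_on \<phi> (carrier A)"
    and img: "(\<lambda>x. \<phi> (n \<oplus>\<^bsub>A\<^esub> x)) ` L = carrier (weak_order R b)"
    using weak_order_translate[OF r(1)] unfolding n_def A_def L_def by blast
  define B where "B = Lam R b"
  interpret A: boolean_rng A using Lam_boolean a A_def by simp
  interpret P: partial_order "weak_order R a" using partial_order_weak_order a .
  have LA: "z \<in> carrier A" if "z \<in> L" for z using that weak_order_subset by (simp add: L_def A_def)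
  have nL: "n \<in> L" using r by (simp add: n_def L_def)
  note nA = LA[OF nL]
  have mult: "\<phi> z \<otimes>\<^bsub>B\<^esub> \<phi> w = \<phi> (z \<otimes>\<^bsub>A\<^esub> w)" if "z \<in> carrier A" "w \<in> carrier A" for z w
    using \<phi> that by (simp add: rng_hom_def B_def)
  have zero: "\<phi> \<zero>\<^bsub>A\<^esub> = \<zero>\<^bsub>B\<^esub>" using rng_hom_zero[OF Lam_boolean[OF a] Lam_boolean[OF b]] \<phi> by (simp add: A_def B_def)
  define t where "t x = \<phi> (n \<oplus>\<^bsub>A\<^esub> x)" for x
  have tL: "t z \<in> carrier (weak_order R b)" if "z \<in> L" for z
    using img that unfolding t_def by blast
  have le0: "t z \<otimes>\<^bsub>B\<^esub> t w = t z \<longleftrightarrow> (n \<oplus>\<^bsub>A\<^esub> z) \<otimes>\<^bsub>A\<^esub> (n \<oplus>\<^bsub>A\<^esub> w) = n \<oplus>\<^bsub>A\<^esub> z" if "z \<in> L" "w \<in> L" for z w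
    using that inj nA LA by (simp add: t_def mult inj_on_eq_iff A.mult_closed)
  have le: "t z \<otimes>\<^bsub>B\<^esub> t w = t z \<longleftrightarrow> z \<otimes>\<^bsub>A\<^esub> w = z"
    if "z \<in> L" "w \<in> L" "n \<otimes>\<^bsub>A\<^esub> z = n" "n \<otimes>\<^bsub>A\<^esub> w = n" for z w
    using that le0 nA LA A.complement_below_iff by simp
  have orth: "t z \<otimes>\<^bsub>B\<^esub> t g = \<zero>\<^bsub>B\<^esub> \<longleftrightarrow> z \<otimes>\<^bsub>A\<^esub> g = \<zero>\<^bsub>A\<^esub>"
    if "z \<in> L" "g \<in> L" "n \<otimes>\<^bsub>A\<^esub> z = n" "n \<otimes>\<^bsub>A\<^esub> g = \<zero>\<^bsub>A\<^esub>" for z g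
  proof -
    have "t z \<otimes>\<^bsub>B\<^esub> t g = \<zero>\<^bsub>B\<^esub> \<longleftrightarrow> \<phi> ((n \<oplus>\<^bsub>A\<^esub> z) \<otimes>\<^bsub>A\<^esub> (n \<oplus>\<^bsub>A\<^esub> g)) = \<phi> \<zero>\<^bsub>A\<^esub>"
      using that nA LA by (simp add: t_def mult zero)
    also have "\<dots> \<longleftrightarrow> (n \<oplus>\<^bsub>A\<^esub> z) \<otimes>\<^bsub>A\<^esub> (n \<oplus>\<^bsub>A\<^esub> g) = \<zero>\<^bsub>A\<^esub>"
      using that nA LA inj by (simp add: inj_on_eq_iff A.mult_closed)
    finally show ?thesis using that nA LA A.complement_orthogonal_iff by simp
  qed
  have xs: "x \<in> L" "y \<in> L" "u \<in> L" "x \<otimes>\<^bsub>A\<^esub> u = x" "y \<otimes>\<^bsub>A\<^esub> u = y" "n \<otimes>\<^bsub>A\<^esub> x = n" "n \<otimes>\<^bsub>A\<^esub> y = n"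
    using x y u by (auto simp: L_def A_def n_def)
  have trans: "z \<otimes>\<^bsub>A\<^esub> w' = z" if "z \<otimes>\<^bsub>A\<^esub> w = z" "w \<otimes>\<^bsub>A\<^esub> w' = w" "z \<in> L" "w \<in> L" "w' \<in> L" for z w w'
    using that LA A.mult_assoc by metis
  have nu: "n \<otimes>\<^bsub>A\<^esub> u = n" using trans[of n x u] xs nL by blast
  \<comment> \<open>\<open>le\<close> compares only elements above \<open>n\<close>; membership
    below \<open>t u\<close> after translation supplies that condition.\<close>
  have above: "n \<otimes>\<^bsub>A\<^esub> z = n" if "z \<in> L" "t z \<otimes>\<^bsub>B\<^esub> t u = t z" for z
    using that A.below_of_complement_below[of n z u] nu nA LA xs le0 by simp
  have low_u: "lower_set a u = {z \<in> L. z \<otimes>\<^bsub>A\<^esub> u = z}" by (auto simp: L_def A_def)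
  have "lower_set b (t u) \<subseteq> t ` {z \<in> L. n \<otimes>\<^bsub>A\<^esub> z = n \<and> z \<otimes>\<^bsub>A\<^esub> u = z}"
  proof
    fix w assume w: "w \<in> lower_set b (t u)"
    then have "w \<in> carrier (weak_order R b)" by blast
    then obtain z where z: "z \<in> L" "w = t z" using img by (auto simp: t_def)
    then have "t z \<otimes>\<^bsub>B\<^esub> t u = t z" using w by (simp add: B_def)
    then show "w \<in> t ` {z \<in> L. n \<otimes>\<^bsub>A\<^esub> z = n \<and> z \<otimes>\<^bsub>A\<^esub> u = z}" using z above le nu xs by blast
  qed
  moreover have "{z \<in> L. n \<otimes>\<^bsub>A\<^esub> z = n \<and> z \<otimes>\<^bsub>A\<^esub> u = z} \<subset> lower_set a u"
  proof -
    \<comment> \<open>Zero makes the inclusion strict: it is below \<open>u\<close> but not above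
      the nonzero \<open>n\<close>.\<close>
    have "\<zero>\<^bsub>A\<^esub> \<in> {z \<in> L. z \<otimes>\<^bsub>A\<^esub> u = z}"
      using weak_order_zero[OF a] A.mult_zero LA xs unfolding L_def A_def by blast
    moreover have "n \<otimes>\<^bsub>A\<^esub> \<zero>\<^bsub>A\<^esub> \<noteq> n" using r nA A.mult_zero by (simp add: n_def A_def)
    ultimately show ?thesis unfolding low_u by blast
  qed
  ultimately have "card (lower_set b (t u)) < card (lower_set a u)"
    using u(2) by (meson card_image_le card_mono finite_imageI finite_subset le_less_trans
        psubset_card_mono psubset_imp_subset)
  moreover have "t x \<in> lower_set b (t u)" "t y \<in> lower_set b (t u)"
    using le[of x u] le[of y u] xs nu tL[of x] tL[of y] by (simp_all add: B_def)
  ultimately obtain j' where j': "orthogonal_join b (t x) (t y) j'"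
    using IH[OF b tL[OF xs(3)]] by blast
  then have lub: "is_lub (weak_order R b) j' {t x, t y}" unfolding orthogonal_join_def by blast
  note lub = lub[unfolded is_lub_pair_iff[OF tL[OF xs(1)] tL[OF xs(2)]]]
  then have "j' \<in> carrier (weak_order R b)" by blast
  then obtain j where j: "j \<in> L" "j' = t j" using img by (auto simp: t_def)
  have jB: "t x \<otimes>\<^bsub>B\<^esub> t j = t x" "t y \<otimes>\<^bsub>B\<^esub> t j = t y"
    "\<And>w. w \<in> L \<Longrightarrow> t x \<otimes>\<^bsub>B\<^esub> t w = t x \<Longrightarrow> t y \<otimes>\<^bsub>B\<^esub> t w = t y \<Longrightarrow> t j \<otimes>\<^bsub>B\<^esub> t w = t j"
    using lub tL unfolding j(2) weak_order_simps(2) B_def by blast+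
  \<comment> \<open>As \<open>t u\<close> bounds \<open>t x\<close> and \<open>t y\<close>, it
    bounds their join; so \<open>j\<close> lies above \<open>n\<close> and the order can be
    reflected back.\<close>
  have "t j \<otimes>\<^bsub>B\<^esub> t u = t j" using jB(3)[of u] le xs nu by blast
  then have nj: "n \<otimes>\<^bsub>A\<^esub> j = n" using above j by blast
  have "is_lub (weak_order R a) j {x, y}"
  proof -
    have "j \<otimes>\<^bsub>A\<^esub> w = j" if w: "w \<in> L" "x \<otimes>\<^bsub>A\<^esub> w = x" "y \<otimes>\<^bsub>A\<^esub> w = y" for w
    proof -
      \<comment> \<open>A competing bound \<open>w\<close> need not be below \<open>u\<close>; being
        above \<open>x\<close>, it is above \<open>n\<close>, which is all that \<open>le\<close>
        requires.\<close>
      have "n \<otimes>\<^bsub>A\<^esub> w = n" using trans[of n x w] w xs nL by blast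
      then show ?thesis using jB(3)[of w] le w xs j nj by blast
    qed
    moreover have "x \<otimes>\<^bsub>A\<^esub> j = x" "y \<otimes>\<^bsub>A\<^esub> j = y" using jB le xs j nj by blast+
    ultimately show ?thesis
      unfolding is_lub_pair_iff[OF xs(1,2)[unfolded L_def]] using j by (simp add: L_def A_def)
  qed
  moreover have "j \<otimes>\<^bsub>A\<^esub> g = \<zero>\<^bsub>A\<^esub>" if g: "g \<in> L" "x \<otimes>\<^bsub>A\<^esub> g = \<zero>\<^bsub>A\<^esub>" "y \<otimes>\<^bsub>A\<^esub> g = \<zero>\<^bsub>A\<^esub>" for g
  proof -
    have ng: "n \<otimes>\<^bsub>A\<^esub> g = \<zero>\<^bsub>A\<^esub>" using A.below_orthogonal[of n x g] LA nA xs g by blast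
    then have "t x \<otimes>\<^bsub>B\<^esub> t g = \<zero>\<^bsub>B\<^esub>" "t y \<otimes>\<^bsub>B\<^esub> t g = \<zero>\<^bsub>B\<^esub>" using orth g xs by blast+
    then have "t j \<otimes>\<^bsub>B\<^esub> t g = \<zero>\<^bsub>B\<^esub>"
      using j' tL[OF g(1)] j unfolding orthogonal_join_def B_def by blast
    then show ?thesis using orth j g nj ng by blast
  qed
  ultimately show ?thesis unfolding orthogonal_join_def A_def L_def by blast
qed

text \<open>\<open>x\<close> and \<open>y\<close> may have no common nonzero element below them, so
  translation does not apply to the pair directly. The join \<open>m\<close> of an atom below each
  is the bridge: \<open>x\<close> and \<open>m\<close> share \<open>r\<close>, and then their join
  \<open>p\<close> and \<open>y\<close> share \<open>s\<close>. All stay below the same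
  \<open>u\<close>, so one induction hypothesis serves both translations.\<close>

lemma bounded_orthogonal_join:
  assumes fin: "interval_finite R"
    and atoms: "\<And>a r s u. \<lbrakk>a \<in> Ob R; r \<in> atomic_morphisms R \<inter> mor_to R a;
        s \<in> atomic_morphisms R \<inter> mor_to R a; u \<in> carrier (weak_order R a);
        cocycle R r \<sqsubseteq>\<^bsub>weak_order R a\<^esub> u; cocycle R s \<sqsubseteq>\<^bsub>weak_order R a\<^esub> u\<rbrakk>
      \<Longrightarrow> \<exists>j. orthogonal_join a (cocycle R r) (cocycle R s) j"
    and "a \<in> Ob R" "u \<in> carrier (weak_order R a)" "x \<in> lower_set a u" "y \<in> lower_set a u"
  shows "\<exists>j. orthogonal_join a x y j"
  using assms(3-)
\<comment> \<open>The object varies too, since the hypothesis is applied at the source of an atomic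
  morphism.\<close>
proof (induction "card (lower_set a u)" arbitrary: a u x y rule: less_induct)
  case less
  note a = less.prems(1) and u = less.prems(2) and x = less.prems(3) and y = less.prems(4)
  let ?W = "weak_order R a"
  interpret L: boolean_rng "Lam R a" using Lam_boolean a by simp
  interpret P: partial_order ?W using partial_order_weak_order a .
  have fin_low: "finite (lower_set a v)" if "v \<in> carrier ?W" for v
    using fin a that unfolding interval_finite_def by auto
  have zero_le: "\<zero>\<^bsub>Lam R a\<^esub> \<sqsubseteq>\<^bsub>?W\<^esub> v" if "v \<in> carrier ?W" for v
    using that L.mult_zero weak_order_subset by auto
  have xc: "x \<in> carrier ?W" "x \<sqsubseteq>\<^bsub>?W\<^esub> u" and yc: "y \<in> carrier ?W" "y \<sqsubseteq>\<^bsub>?W\<^esub> u"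
    using x y by blast+
  note pair = is_lub_pair_iff[where L = ?W]
  consider "x = \<zero>\<^bsub>Lam R a\<^esub>" | "y = \<zero>\<^bsub>Lam R a\<^esub>" | "x \<noteq> \<zero>\<^bsub>Lam R a\<^esub>" "y \<noteq> \<zero>\<^bsub>Lam R a\<^esub>" by blast
  then show ?case
  proof cases
    case 1
    then have "orthogonal_join a x y y"
      unfolding orthogonal_join_def pair[OF xc(1) yc(1)] using zero_le yc P.le_refl by blast
    then show ?thesis ..
  next
    case 2
    then have "orthogonal_join a x y x"
      unfolding orthogonal_join_def pair[OF xc(1) yc(1)] using zero_le xc P.le_refl by blast
    then show ?thesis ..
  next
    case 3
    obtain r where r: "r \<in> atomic_morphisms R \<inter> mor_to R a" "cocycle R r \<sqsubseteq>\<^bsub>?W\<^esub> x"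
      using exists_atom_below[OF a xc(1) 3(1) fin_low[OF xc(1)]] by blast
    obtain s where s: "s \<in> atomic_morphisms R \<inter> mor_to R a" "cocycle R s \<sqsubseteq>\<^bsub>?W\<^esub> y"
      using exists_atom_below[OF a yc(1) 3(2) fin_low[OF yc(1)]] by blast
    have rc: "cocycle R r \<in> carrier ?W" and sc: "cocycle R s \<in> carrier ?W" using r s by auto
    have nz: "cocycle R t \<noteq> \<zero>\<^bsub>Lam R a\<^esub>" if "t \<in> atomic_morphisms R \<inter> mor_to R a" for t
      using that weak_order_least_iff[OF a]
      by (auto simp: atomic_morphisms_def is_atom_def mor_to_def)
    have ru: "cocycle R r \<sqsubseteq>\<^bsub>?W\<^esub> u" and su: "cocycle R s \<sqsubseteq>\<^bsub>?W\<^esub> u"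
      using P.le_trans[OF r(2) xc(2) rc xc(1) u] P.le_trans[OF s(2) yc(2) sc yc(1) u] by blast+
    obtain m where m: "orthogonal_join a (cocycle R r) (cocycle R s) m"
      using atoms[OF a r(1) s(1) u ru su] by blast
    note mlub = m[unfolded orthogonal_join_def pair[OF rc sc]]
    have mc: "m \<in> carrier ?W" "m \<sqsubseteq>\<^bsub>?W\<^esub> u" "cocycle R r \<sqsubseteq>\<^bsub>?W\<^esub> m" "cocycle R s \<sqsubseteq>\<^bsub>?W\<^esub> m"
      using mlub ru su u by blast+
    have "\<exists>p. orthogonal_join a x m p"
      using orthogonal_join_translate[of r a u x m, OF _ nz[OF r(1)] u fin_low[OF u] x r(2) _ mc(3)]
        less.hyps r(1) mc by blast
    then obtain p where p: "orthogonal_join a x m p" by blast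
    note plub = p[unfolded orthogonal_join_def pair[OF xc(1) mc(1)]]
    have pc: "p \<in> carrier ?W" "p \<sqsubseteq>\<^bsub>?W\<^esub> u" "x \<sqsubseteq>\<^bsub>?W\<^esub> p" "m \<sqsubseteq>\<^bsub>?W\<^esub> p"
      using plub xc mc u by blast+
    \<comment> \<open>Passing through \<open>m\<close> has placed \<open>p\<close> above
      \<open>s\<close>, so a second translation, now by \<open>s\<close>, applies to
      \<open>p\<close> and \<open>y\<close>.\<close>
    have sp: "cocycle R s \<sqsubseteq>\<^bsub>?W\<^esub> p" using P.le_trans[OF mc(4) pc(4) sc mc(1) pc(1)] .
    have "\<exists>q. orthogonal_join a p y q"
      using orthogonal_join_translate[of s a u p y, OF _ nz[OF s(1)] u fin_low[OF u] _ sp y s(2)]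
        less.hyps s(1) pc by blast
    then obtain q where q: "orthogonal_join a p y q" by blast
    note qlub = q[unfolded orthogonal_join_def pair[OF pc(1) yc(1)]]
    have qc: "q \<in> carrier ?W" "p \<sqsubseteq>\<^bsub>?W\<^esub> q" "y \<sqsubseteq>\<^bsub>?W\<^esub> q" using qlub by blast+
    have "x \<sqsubseteq>\<^bsub>?W\<^esub> q" using P.le_trans[OF pc(3) qc(2) xc(1) pc(1) qc(1)] .
    moreover have "q \<sqsubseteq>\<^bsub>?W\<^esub> w" if w: "w \<in> carrier ?W" "x \<sqsubseteq>\<^bsub>?W\<^esub> w" "y \<sqsubseteq>\<^bsub>?W\<^esub> w" for w
    proof -
      \<comment> \<open>A bound of \<open>x\<close> and \<open>y\<close> also bounds the atoms,
        hence in turn \<open>m\<close>, \<open>p\<close> and \<open>q\<close>; orthogonality passes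
        along the same chain below.\<close>
      have "cocycle R r \<sqsubseteq>\<^bsub>?W\<^esub> w" "cocycle R s \<sqsubseteq>\<^bsub>?W\<^esub> w"
        using P.le_trans[OF r(2) w(2) rc xc(1) w(1)] P.le_trans[OF s(2) w(3) sc yc(1) w(1)] by blast+
      then have "m \<sqsubseteq>\<^bsub>?W\<^esub> w" using mlub w(1) by blast
      then have "p \<sqsubseteq>\<^bsub>?W\<^esub> w" using plub w(1,2) by blast
      then show ?thesis using qlub w(1,3) by blast
    qed
    moreover have "q \<otimes>\<^bsub>Lam R a\<^esub> g = \<zero>\<^bsub>Lam R a\<^esub>"
      if g: "g \<in> carrier ?W" "x \<otimes>\<^bsub>Lam R a\<^esub> g = \<zero>\<^bsub>Lam R a\<^esub>" "y \<otimes>\<^bsub>Lam R a\<^esub> g = \<zero>\<^bsub>Lam R a\<^esub>" for g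
    proof -
      have "cocycle R r \<otimes>\<^bsub>Lam R a\<^esub> g = \<zero>\<^bsub>Lam R a\<^esub>" "cocycle R s \<otimes>\<^bsub>Lam R a\<^esub> g = \<zero>\<^bsub>Lam R a\<^esub>"
        using L.below_orthogonal[of "cocycle R r" x g] L.below_orthogonal[of "cocycle R s" y g]
          weak_order_subset rc sc xc yc r s g by simp_all
      then have "m \<otimes>\<^bsub>Lam R a\<^esub> g = \<zero>\<^bsub>Lam R a\<^esub>" using mlub g(1) by blast
      then have "p \<otimes>\<^bsub>Lam R a\<^esub> g = \<zero>\<^bsub>Lam R a\<^esub>" using plub g(1,2) by blast
      then show ?thesis using qlub g(1,3) by blast
    qed
    ultimately have "orthogonal_join a x y q"
      unfolding orthogonal_join_def pair[OF xc(1) yc(1)] using qc by blast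
    then show ?thesis ..
  qed
qed

section \<open>From joins of bounded pairs to the rootoid axioms\<close>

lemma rootoid_of_bounded_orthogonal_joins:
  assumes fin: "interval_finite R" and faith: "faithful R"
    and joins: "\<And>a u x y. \<lbrakk>a \<in> Ob R; u \<in> carrier (weak_order R a); x \<in> lower_set a u;
        y \<in> lower_set a u\<rbrakk> \<Longrightarrow> \<exists>j. orthogonal_join a x y j"
  shows "rootoid R"
proof unfold_locales
  fix a
  show "inj_on (cocycle R) (mor_to R a)" using faithful_cocycle_inj faith .
next
  fix a assume a: "a \<in> Ob R"
  let ?W = "weak_order R a"
  interpret L: boolean_rng "Lam R a" using Lam_boolean a by simp
  interpret P: partial_order ?W using partial_order_weak_order a .
  note pair = is_lub_pair_iff[where L = ?W]
  have "\<exists>m. is_glb ?W m X" if X: "X \<subseteq> carrier ?W" "X \<noteq> {}" for X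
  proof (rule P.finite_directed_greatest)
    obtain x where x: "x \<in> X" using X by blast
    \<comment> \<open>A single member of \<open>X\<close> bounds all the lower bounds, which makes
      them finite in number and gives every pair of them a join.\<close>
    have "Lower ?W X \<subseteq> lower_set a x" using x X unfolding Lower_def by blast
    moreover have "finite (lower_set a x)"
      using fin a x X unfolding interval_finite_def by auto
    ultimately show "finite (Lower ?W X)" by (rule finite_subset)
    have "\<zero>\<^bsub>Lam R a\<^esub> \<in> Lower ?W X"
      using weak_order_zero[OF a] L.mult_zero weak_order_subset[of _ a] unfolding Lower_def by auto
    then show "Lower ?W X \<noteq> {}" by blast
    show "Lower ?W X \<subseteq> carrier ?W" unfolding Lower_def by blast
    have low: "l \<in> Lower ?W X \<longleftrightarrow> l \<in> carrier ?W \<and> (\<forall>w\<in>X. l \<sqsubseteq>\<^bsub>?W\<^esub> w)" for l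
      using X(1) unfolding Lower_def by blast
    fix y z assume "y \<in> Lower ?W X" and "z \<in> Lower ?W X"
    then have y: "y \<in> carrier ?W" "\<forall>w\<in>X. y \<sqsubseteq>\<^bsub>?W\<^esub> w" and z: "z \<in> carrier ?W" "\<forall>w\<in>X. z \<sqsubseteq>\<^bsub>?W\<^esub> w"
      unfolding low by blast+
    have "y \<in> lower_set a x" "z \<in> lower_set a x" using x y z by blast+
    then obtain j where "orthogonal_join a y z j" using joins[OF a subsetD[OF X(1) x]] by blast
    then have j: "j \<in> carrier ?W" "y \<sqsubseteq>\<^bsub>?W\<^esub> j" "z \<sqsubseteq>\<^bsub>?W\<^esub> j"
      "\<And>w. w \<in> carrier ?W \<Longrightarrow> y \<sqsubseteq>\<^bsub>?W\<^esub> w \<Longrightarrow> z \<sqsubseteq>\<^bsub>?W\<^esub> w \<Longrightarrow> j \<sqsubseteq>\<^bsub>?W\<^esub> w"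
      unfolding orthogonal_join_def pair[OF y(1) z(1)] by blast+
    \<comment> \<open>Each element of \<open>X\<close> is an upper bound of \<open>y\<close> and
      \<open>z\<close>, hence above their join.\<close>
    have "j \<in> Lower ?W X" unfolding low using j(1,4) y(2) z(2) X(1) by (meson subsetD)
    then show "\<exists>w\<in>Lower ?W X. y \<sqsubseteq>\<^bsub>?W\<^esub> w \<and> z \<sqsubseteq>\<^bsub>?W\<^esub> w" using j(2,3) by (intro bexI conjI)
  qed
  then show "complete_meet_semilattice ?W"
    unfolding complete_meet_semilattice_def using P.partial_order_axioms by blast
next
  fix a X B J
  assume a: "a \<in> Ob R" and X: "X \<subseteq> carrier (weak_order R a)" and B: "B \<in> carrier (weak_order R a)"
    and XB: "\<And>A. A \<in> X \<Longrightarrow> A \<otimes>\<^bsub>Lam R a\<^esub> B = \<zero>\<^bsub>Lam R a\<^esub>" and J: "is_lub (weak_order R a) J X"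
  let ?W = "weak_order R a"
  interpret L: boolean_rng "Lam R a" using Lam_boolean a by simp
  interpret P: partial_order ?W using partial_order_weak_order a .
  note pair = is_lub_pair_iff[where L = ?W]
  \<comment> \<open>\<open>D\<close> contains \<open>X\<close> and has a greatest element
    \<open>m\<close>, so the least upper bound \<open>J\<close> is below \<open>m\<close> and
    inherits its orthogonality to \<open>B\<close>. Zero belongs to \<open>D\<close>, which covers
    an empty \<open>X\<close>.\<close>
  define D where "D = {x \<in> lower_set a J. x \<otimes>\<^bsub>Lam R a\<^esub> B = \<zero>\<^bsub>Lam R a\<^esub>}"
  have J': "J \<in> carrier ?W" "\<And>x. x \<in> X \<Longrightarrow> x \<sqsubseteq>\<^bsub>?W\<^esub> J"
    "\<And>w. w \<in> carrier ?W \<Longrightarrow> \<forall>x\<in>X. x \<sqsubseteq>\<^bsub>?W\<^esub> w \<Longrightarrow> J \<sqsubseteq>\<^bsub>?W\<^esub> w"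
    using J X unfolding least_def Upper_def by blast+
  have "\<exists>m. greatest ?W m D"
  proof (rule P.finite_directed_greatest)
    have "finite (lower_set a J)" using fin a J'(1) unfolding interval_finite_def by auto
    then show "finite D" unfolding D_def by (rule finite_subset[rotated]) blast
    have "\<zero>\<^bsub>Lam R a\<^esub> \<in> D"
      using weak_order_zero[OF a] L.mult_zero weak_order_subset B J'(1) unfolding D_def by simp
    then show "D \<noteq> {}" by blast
    show "D \<subseteq> carrier ?W" unfolding D_def by blast
    fix y z assume yz: "y \<in> D" "z \<in> D"
    then have c: "y \<in> carrier ?W" "z \<in> carrier ?W" unfolding D_def by blast+
    obtain j where "orthogonal_join a y z j" using joins[OF a J'(1)] yz unfolding D_def by blast
    note j = this[unfolded orthogonal_join_def pair[OF c]]
    then have "j \<in> D" using yz J'(1) B unfolding D_def by blast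
    then show "\<exists>w\<in>D. y \<sqsubseteq>\<^bsub>?W\<^esub> w \<and> z \<sqsubseteq>\<^bsub>?W\<^esub> w" using j by blast
  qed
  then obtain m where m: "m \<in> D" "\<forall>x\<in>D. x \<sqsubseteq>\<^bsub>?W\<^esub> m" unfolding greatest_def by blast
  have mc: "m \<in> carrier ?W" "m \<sqsubseteq>\<^bsub>?W\<^esub> J" "m \<otimes>\<^bsub>Lam R a\<^esub> B = \<zero>\<^bsub>Lam R a\<^esub>"
    using m(1) unfolding D_def by blast+
  have "X \<subseteq> D" using X J'(2) XB unfolding D_def by blast
  then have "J \<sqsubseteq>\<^bsub>?W\<^esub> m" using J'(3)[OF mc(1)] m(2) by blast
  then show "J \<otimes>\<^bsub>Lam R a\<^esub> B = \<zero>\<^bsub>Lam R a\<^esub>"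
    using L.below_orthogonal[of J m B] mc weak_order_subset J'(1) B by simp
qed

end

section \<open>Joins in a rootoid, and the equivalence\<close>

text \<open>The join is the meet of all upper bounds, a set that contains \<open>u\<close>. Since
  \<open>x\<close> and \<open>y\<close> are lower bounds of that set, its meet is again an upper
  bound of both.\<close>

lemma (in rootoid) bounded_pair_lub:
  assumes a: "a \<in> Ob R" and x: "x \<in> carrier (weak_order R a)" "x \<sqsubseteq>\<^bsub>weak_order R a\<^esub> u"
    and y: "y \<in> carrier (weak_order R a)" "y \<sqsubseteq>\<^bsub>weak_order R a\<^esub> u"
    and u: "u \<in> carrier (weak_order R a)"
  shows "\<exists>j. is_lub (weak_order R a) j {x, y}"
proof -
  let ?W = "weak_order R a"
  let ?U = "Upper ?W {x, y}"
  have U: "w \<in> ?U \<longleftrightarrow> w \<in> carrier ?W \<and> x \<sqsubseteq>\<^bsub>?W\<^esub> w \<and> y \<sqsubseteq>\<^bsub>?W\<^esub> w" for w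
    using x y unfolding Upper_def by blast
  have sub: "?U \<subseteq> carrier ?W" using U by blast
  moreover have "?U \<noteq> {}" using U u x y by blast
  ultimately obtain m where m: "is_glb ?W m ?U"
    using weak_order_meets[OF a] unfolding complete_meet_semilattice_def by blast
  have low: "l \<in> Lower ?W ?U \<longleftrightarrow> l \<in> carrier ?W \<and> (\<forall>w\<in>?U. l \<sqsubseteq>\<^bsub>?W\<^esub> w)" for l
    using sub unfolding Lower_def by blast
  have "x \<in> Lower ?W ?U" "y \<in> Lower ?W ?U" using low U x y by blast+
  then have "m \<in> ?U" "\<forall>w\<in>?U. m \<sqsubseteq>\<^bsub>?W\<^esub> w"
    using m low U unfolding greatest_def by blast+
  then show ?thesis using sub unfolding least_def by blast
qed

theorem proposition6p9:
  fixes R :: "('o, 'm, 'b) protorootoid_data"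
  assumes "protorootoid R" and "interval_finite R" and "faithful R"
  shows "rootoid R \<longleftrightarrow>
    (\<forall>a \<in> Ob R.
      \<forall>r \<in> atomic_morphisms R \<inter> mor_to R a.
      \<forall>s \<in> atomic_morphisms R \<inter> mor_to R a.
      \<forall>g \<in> mor_to R a.
        cocycle R r \<otimes>\<^bsub>Lam R a\<^esub> cocycle R g = \<zero>\<^bsub>Lam R a\<^esub> \<and>
        cocycle R s \<otimes>\<^bsub>Lam R a\<^esub> cocycle R g = \<zero>\<^bsub>Lam R a\<^esub> \<and>
        (\<exists>u \<in> carrier (weak_order R a).
          cocycle R r \<sqsubseteq>\<^bsub>weak_order R a\<^esub> u \<and> cocycle R s \<sqsubseteq>\<^bsub>weak_order R a\<^esub> u) \<longrightarrow>
        (\<exists>j. is_lub (weak_order R a) j {cocycle R r, cocycle R s} \<and>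
          j \<otimes>\<^bsub>Lam R a\<^esub> cocycle R g = \<zero>\<^bsub>Lam R a\<^esub>))"
    (is "_ \<longleftrightarrow> ?C")
proof
  assume "rootoid R"
  then interpret rootoid R .
  show ?C
  proof (intro ballI impI, elim conjE bexE)
    fix a r s g u
    assume a: "a \<in> Ob R" and r: "r \<in> atomic_morphisms R \<inter> mor_to R a"
      and s: "s \<in> atomic_morphisms R \<inter> mor_to R a" and g: "g \<in> mor_to R a"
      and rg: "cocycle R r \<otimes>\<^bsub>Lam R a\<^esub> cocycle R g = \<zero>\<^bsub>Lam R a\<^esub>"
      and sg: "cocycle R s \<otimes>\<^bsub>Lam R a\<^esub> cocycle R g = \<zero>\<^bsub>Lam R a\<^esub>"
      and u: "u \<in> carrier (weak_order R a)" "cocycle R r \<sqsubseteq>\<^bsub>weak_order R a\<^esub> u"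
        "cocycle R s \<sqsubseteq>\<^bsub>weak_order R a\<^esub> u"
    have c: "cocycle R r \<in> carrier (weak_order R a)" "cocycle R s \<in> carrier (weak_order R a)"
      "cocycle R g \<in> carrier (weak_order R a)"
      using r s g by simp_all
    obtain j where j: "is_lub (weak_order R a) j {cocycle R r, cocycle R s}"
      using bounded_pair_lub[OF a c(1) u(2) c(2) u(3) u(1)] by blast
    have "j \<otimes>\<^bsub>Lam R a\<^esub> cocycle R g = \<zero>\<^bsub>Lam R a\<^esub>"
      by (rule join_orthogonal[OF a _ c(3) _ j]) (use c rg sg in auto)
    then show "\<exists>j. is_lub (weak_order R a) j {cocycle R r, cocycle R s} \<and>
        j \<otimes>\<^bsub>Lam R a\<^esub> cocycle R g = \<zero>\<^bsub>Lam R a\<^esub>"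
      using j by blast
  qed
next
  assume C: ?C
  interpret protorootoid R by fact
  have atoms: "\<exists>j. orthogonal_join a (cocycle R r) (cocycle R s) j"
    if a: "a \<in> Ob R" and r: "r \<in> atomic_morphisms R \<inter> mor_to R a"
      and s: "s \<in> atomic_morphisms R \<inter> mor_to R a" and u: "u \<in> carrier (weak_order R a)"
      "cocycle R r \<sqsubseteq>\<^bsub>weak_order R a\<^esub> u" "cocycle R s \<sqsubseteq>\<^bsub>weak_order R a\<^esub> u"
    for a r s u
  proof -
    interpret L: boolean_rng "Lam R a" using Lam_boolean a by simp
    interpret P: partial_order "weak_order R a" using partial_order_weak_order a .
    have C': "\<exists>j. is_lub (weak_order R a) j {cocycle R r, cocycle R s} \<and> j \<otimes>\<^bsub>Lam R a\<^esub> g = \<zero>\<^bsub>Lam R a\<^esub>"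
      if "g \<in> carrier (weak_order R a)" "cocycle R r \<otimes>\<^bsub>Lam R a\<^esub> g = \<zero>\<^bsub>Lam R a\<^esub>"
        "cocycle R s \<otimes>\<^bsub>Lam R a\<^esub> g = \<zero>\<^bsub>Lam R a\<^esub>" for g
    proof -
      obtain h where "h \<in> mor_to R a" "g = cocycle R h" using \<open>g \<in> _\<close> by auto
      then show ?thesis using C a r s u that by blast
    qed
    have "cocycle R r \<in> carrier (Lam R a)" "cocycle R s \<in> carrier (Lam R a)"
      using r s cocycle_in_Lam by blast+
    \<comment> \<open>Zero is orthogonal to everything, so the condition at zero yields a join
      without any assumption on \<open>g\<close>.\<close>
    then obtain j where j: "is_lub (weak_order R a) j {cocycle R r, cocycle R s}"
      using C'[OF weak_order_zero[OF a]] L.mult_zero(1) by blast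
    \<comment> \<open>By uniqueness, the joins that \<open>C'\<close> provides for the various
      \<open>g\<close> are all this \<open>j\<close>.\<close>
    have "j' = j" if "is_lub (weak_order R a) j' {cocycle R r, cocycle R s}" for j'
      using P.least_unique[OF that j] .
    then show ?thesis unfolding orthogonal_join_def using j C' by blast
  qed
  show "rootoid R"
    by (rule rootoid_of_bounded_orthogonal_joins[OF assms(2,3)])
      (rule bounded_orthogonal_join[OF assms(2) atoms])
qed

end
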